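(* There exists a polynomial $h\in\mathbb{C}[x]$ of degree $6$ such that, for $p$ not a critical value of $h^{\circ 2}$ and $R_2=\{x\in\mathbb{C}: h^{\circ 2}(x)=p\}$, the set $R_2$ contains an $MG_2(h)$-block with exactly $4$ elements, two each in two different major branches of $R_2$. Moreover, $h$ can be chosen so that it also has the following property: there is a bounded Fatou component $V$ of $h$ that is eventually mapped onto a periodic (super-)attracting basin or attracting petal, such that for every integer $N\ge 1$ and every admissible pair $(p,E)$ for $(h,V,N)$, the smallest $MG_N(h)$-block of $S=\{x\in\mathbb{C}: h^{\circ N}(x)=p\}$ containing $E$ has at most $6^{N-1}$ elements.
   Context: For a polynomial $f\in\mathbb{C}[x]$ of degree $d$, $f^{\circ n}$ is the $n$th iterate. Let $\mathcal V_n$ be the set of critical values of $f^{\circ n}$. For $p\in\mathbb{C}\setminus \mathcal V_n$, lifting closed loops at $p$ in $\mathbb{C}\setminus \mathcal V_n$ through $f^{\circ n}$ gives an action of $\pi_1(\mathbb{C}\setminus \mathcal V_n,p)$ on $R_n=\{x: f^{\circ n}(x)=p\}$, which has $d^n$ elements; the resulting group of permutations is the monodromy group $MG_n(f)=MG(f^{\circ n})$. The major branches of $R_n$ are the $d$ sets $\{y\in R_n: f^{\circ (n-1)}(y)=x\}$, where $x$ ranges over $R_1=f^{-1}(p)$. If a group $G$ acts on a finite set $S$, a subset $E\subseteq S$ is a $G$-block if for every $g\in G$ the set $g(E)\cap E$ is equal to either $E$ or $\emptyset$. Admissible pairs. Let $f$ be a polynomial of degree $d\ge 2$, let $V$ be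 a bounded Fatou component of $f$ that is eventually mapped onto a periodic (super-)attracting basin or attracting petal (i.e. onto a periodic Fatou component of attracting, super-attracting or parabolic type), and let $N\ge 1$. A pair $(p,E)$ is admissible for $(f,V,N)$ in the following cases. (1) Attracting basin or attracting petal: $p\in f^{\circ N}(V)$ has $d^N$ distinct preimages under $f^{\circ N}$, $S=(f^{\circ N})^{-1}(p)$, and $E=S\cap V$. (2) Super-attracting basin: $U\subset f^{\circ N}(V)$ is an (arbitrarily small) neighborhood of the super-attracting periodic point in $f^{\circ N}(V)$, $p\in U$ has $d^N$ distinct preimages under $f^{\circ N}$, $S=(f^{\circ N})^{-1}(p)$, and $E$ is the set of points of $S$ that lie in one chosen connected component of $(f^{\circ N})^{-1}(U)$ contained in $V$. *)

theory Defs
  imports "HOL-Analysis.Analysis" "HOL-Computational_Algebra.Polynomial"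
    "HOL-Combinatorics.Permutations"
begin

section \<open>Monodromy\<close>

definition fibre :: "(complex \<Rightarrow> complex) \<Rightarrow> complex \<Rightarrow> complex set" where
  "fibre g p = {x. g x = p}"

definition critical_values :: "(complex \<Rightarrow> complex) \<Rightarrow> complex set" where
  "critical_values g = {g c | c. deriv g c = 0}"

definition is_lift :: "(complex \<Rightarrow> complex) \<Rightarrow> (real \<Rightarrow> complex) \<Rightarrow> (real \<Rightarrow> complex) \<Rightarrow> bool" where
  "is_lift g \<gamma> \<delta> \<longleftrightarrow> path \<delta> \<and> (\<forall>t\<in>{0..1}. g (\<delta> t) = \<gamma> t)"

text \<open>
  The loop \<open>\<gamma>\<close> acts on the fibre by sending \<open>x\<close> to the end point of the lift of \<open>\<gamma>\<close> that starts
  at \<open>x\<close>. Permutations of the fibre are represented as functions that are the identity outside of it.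
  Meaningful when \<open>g\<close> is a nonconstant polynomial function and \<open>p\<close> is not a critical value of \<open>g\<close>.
\<close>
definition monodromy_group :: "(complex \<Rightarrow> complex) \<Rightarrow> complex \<Rightarrow> (complex \<Rightarrow> complex) set" where
  "monodromy_group g p =
     {\<sigma>. \<sigma> permutes fibre g p \<and>
         (\<exists>\<gamma>. path \<gamma> \<and> path_image \<gamma> \<subseteq> - critical_values g \<and> pathstart \<gamma> = p \<and> pathfinish \<gamma> = p \<and>
              (\<forall>x\<in>fibre g p. \<exists>\<delta>. is_lift g \<gamma> \<delta> \<and> pathstart \<delta> = x \<and> pathfinish \<delta> = \<sigma> x))}"

definition major_branches :: "complex poly \<Rightarrow> nat \<Rightarrow> complex \<Rightarrow> complex set set" where
  "major_branches f n p =
     {{y \<in> fibre (poly f ^^ n) p. (poly f ^^ (n - 1)) y = x} | x. x \<in> fibre (poly f) p}"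

definition is_block :: "('a \<Rightarrow> 'a) set \<Rightarrow> 'a set \<Rightarrow> 'a set \<Rightarrow> bool" where
  "is_block G S E \<longleftrightarrow> E \<subseteq> S \<and> (\<forall>g\<in>G. g ` E \<inter> E = E \<or> g ` E \<inter> E = {})"

definition is_smallest_block :: "('a \<Rightarrow> 'a) set \<Rightarrow> 'a set \<Rightarrow> 'a set \<Rightarrow> 'a set \<Rightarrow> bool" where
  "is_smallest_block G S E B \<longleftrightarrow>
     is_block G S B \<and> E \<subseteq> B \<and> (\<forall>B'. is_block G S B' \<and> E \<subseteq> B' \<longrightarrow> B \<subseteq> B')"


section \<open>Fatou components\<close>

text \<open>
  Normality of a family of holomorphic functions on a connected open set, with \<open>\<infinity>\<close> admitted as
  limit function, as is appropriate for maps into the Riemann sphere.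
\<close>
definition normal_family_on :: "complex set \<Rightarrow> (complex \<Rightarrow> complex) set \<Rightarrow> bool" where
  "normal_family_on U \<F> \<longleftrightarrow>
     (\<forall>F :: nat \<Rightarrow> complex \<Rightarrow> complex. range F \<subseteq> \<F> \<longrightarrow>
        (\<exists>r :: nat \<Rightarrow> nat. strict_mono r \<and>
           ((\<exists>g. \<forall>K. compact K \<and> K \<subseteq> U \<longrightarrow> uniform_limit K (\<lambda>n. F (r n)) g sequentially) \<or>
            (\<forall>K. compact K \<and> K \<subseteq> U \<longrightarrow>
               (\<forall>B. \<forall>\<^sub>F n in sequentially. \<forall>z\<in>K. B < norm (F (r n) z))))))"

text \<open>
  The part of the Fatou set in the plane; removing \<open>\<infinity>\<close> from its Fatou component
  leaves a connected unbounded set, so the bounded components are the usual ones.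
\<close>
definition fatou_set :: "complex poly \<Rightarrow> complex set" where
  "fatou_set f = {z. \<exists>U. open U \<and> connected U \<and> z \<in> U \<and>
                        normal_family_on U (range (\<lambda>n. poly f ^^ n))}"

definition fatou_component :: "complex poly \<Rightarrow> complex set \<Rightarrow> bool" where
  "fatou_component f V \<longleftrightarrow> V \<in> components (fatou_set f)"

definition attracting_component :: "complex poly \<Rightarrow> complex set \<Rightarrow> bool" where
  "attracting_component f W \<longleftrightarrow> fatou_component f W \<and>
     (\<exists>m>0. (poly f ^^ m) ` W = W \<and>
        (\<exists>z\<in>W. (poly f ^^ m) z = z \<and> deriv (poly f ^^ m) z \<noteq> 0 \<and> norm (deriv (poly f ^^ m) z) < 1))"

definition superattracting_point :: "complex poly \<Rightarrow> complex \<Rightarrow> bool" where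
  "superattracting_point f z \<longleftrightarrow> (\<exists>m>0. (poly f ^^ m) z = z \<and> deriv (poly f ^^ m) z = 0)"

definition superattracting_component :: "complex poly \<Rightarrow> complex set \<Rightarrow> bool" where
  "superattracting_component f W \<longleftrightarrow> fatou_component f W \<and>
     (\<exists>m>0. (poly f ^^ m) ` W = W) \<and> (\<exists>z\<in>W. superattracting_point f z)"

text \<open>
  The iterate that fixes \<open>W\<close> also fixes the attracting petal, which is why the multiplier below
  is \<open>1\<close> and not just a root of unity.
\<close>
definition parabolic_component :: "complex poly \<Rightarrow> complex set \<Rightarrow> bool" where
  "parabolic_component f W \<longleftrightarrow> fatou_component f W \<and>
     (\<exists>m>0. (poly f ^^ m) ` W = W \<and>
        (\<exists>z\<in>frontier W. (poly f ^^ m) z = z \<and> deriv (poly f ^^ m) z = 1 \<and>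
           (\<forall>x\<in>W. (\<lambda>n. (poly f ^^ (m * n)) x) \<longlonglongrightarrow> z)))"

definition eventually_onto :: "(complex set \<Rightarrow> bool) \<Rightarrow> complex poly \<Rightarrow> complex set \<Rightarrow> bool" where
  "eventually_onto P f V \<longleftrightarrow> (\<exists>k. P ((poly f ^^ k) ` V))"

definition eventually_attracted :: "complex poly \<Rightarrow> complex set \<Rightarrow> bool" where
  "eventually_attracted f V \<longleftrightarrow>
     eventually_onto (attracting_component f) f V \<or>
     eventually_onto (parabolic_component f) f V \<or>
     eventually_onto (superattracting_component f) f V"

text \<open>
  \<open>V\<close> is meant to be a bounded Fatou component of \<open>f\<close> with \<open>eventually_attracted f V\<close>. Attracting
  components have nonzero multiplier, so the two cases are disjoint. In the second one \<open>U\<close> is any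
  neighbourhood of the super-attracting periodic point \<open>w\<close>.
\<close>
definition admissible_pair ::
    "complex poly \<Rightarrow> complex set \<Rightarrow> nat \<Rightarrow> complex \<Rightarrow> complex set \<Rightarrow> bool" where
  "admissible_pair f V N p E \<longleftrightarrow>
     card (fibre (poly f ^^ N) p) = degree f ^ N \<and>
     ((eventually_onto (attracting_component f) f V \<or>
       eventually_onto (parabolic_component f) f V) \<and>
      p \<in> (poly f ^^ N) ` V \<and> E = fibre (poly f ^^ N) p \<inter> V
      \<or>
      eventually_onto (superattracting_component f) f V \<and>
      (\<exists>w U C. superattracting_point f w \<and> w \<in> interior U \<and> U \<subseteq> (poly f ^^ N) ` V \<and> p \<in> U \<and>
          C \<in> components ((poly f ^^ N) -` U) \<and> C \<subseteq> V \<and>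
          E = fibre (poly f ^^ N) p \<inter> C))"

end

theory Submission
  imports Defs "HOL-Complex_Analysis.Complex_Analysis"
    "HOL-Computational_Algebra.Fundamental_Theorem_Algebra"
begin

text \<open>
  Take \<open>h = a \<circ> b\<close> with \<open>b = x\<^sup>2 - 1\<close> and \<open>a = 100 u\<^sup>3 - 101 u\<close>. As \<open>a\<close> is odd, \<open>b \<circ> a = c \<circ> x\<^sup>2\<close> for a
  cubic \<open>c\<close>, so \<open>h \<circ> h = (a \<circ> c) \<circ> b\<^sup>2\<close>. Fibres of right factors are blocks, and those of \<open>b\<^sup>2\<close> are the
  sets \<open>{\<plusminus>y, \<plusminus>z}\<close> with \<open>b z = - b y\<close>, hence \<open>h z = - h y\<close>.

  The coefficients are such that \<open>0 \<mapsto> 1 \<mapsto> 0\<close> is a super-attracting cycle, and are so large that the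
  Fatou components \<open>W\<close> of \<open>0\<close> and \<open>V\<close> of \<open>1\<close> lie in small sets on which \<open>a \<circ> b\<close> is under control:
  \<open>h\<close> is injective on \<open>V\<close>, and only identifies \<open>x\<close> with \<open>-x\<close> on \<open>W\<close>. For odd \<open>N\<close>, \<open>h\<close> is injective on
  \<open>V = h\<^bsup>N-1\<^esup>(V)\<close>, so all points of \<open>E\<close> lie in one fibre of \<open>h\<^bsup>N-1\<^esup>\<close>. For even \<open>N\<close>, if \<open>x, y \<in> V = h\<^bsup>N-2\<^esup>(V)\<close>
  satisfy \<open>h (h x) = h (h y)\<close>, then \<open>h x = \<plusminus> h y\<close>, so \<open>b x = \<plusminus> b y\<close> because \<open>a\<close> is odd, and is injective
  near \<open>0\<close>; hence \<open>E\<close> lies in one fibre of \<open>b\<^sup>2 \<circ> h\<^bsup>N-2\<^esup>\<close>, which has degree \<open>4 \<cdot> 6\<^bsup>N-2\<^esup>\<close>.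
\<close>

section \<open>Blocks from right factors\<close>

lemma holomorphic_on_poly: "poly p holomorphic_on S"
  unfolding holomorphic_on_def field_differentiable_def
  using poly_DERIV has_field_derivative_at_within by blast

text \<open>The times at which the two lifts agree form a clopen subset of the unit interval. It is
  closed by continuity. It is open because \<open>g\<close> is injective near a common point, whose
  derivative is nonzero as \<open>\<gamma>\<close> avoids the critical values.\<close>

lemma lift_unique:
  assumes "g holomorphic_on UNIV" and "path_image \<gamma> \<subseteq> - critical_values g"
    and l1: "is_lift g \<gamma> \<delta>" and l2: "is_lift g \<gamma> \<delta>'" and start: "pathstart \<delta> = pathstart \<delta>'"
  shows "pathfinish \<delta> = pathfinish \<delta>'"
proof -
  define T where "T = {t \<in> {0..1}. \<delta> t = \<delta>' t}"
  have c: "continuous_on {0..1} \<delta>" "continuous_on {0..1} \<delta>'"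
    using l1 l2 by (auto simp: is_lift_def path_def)
  have "closedin (top_of_set {0..1}) {t \<in> {0..1}. \<delta> t - \<delta>' t = 0}"
    by (intro continuous_closedin_preimage_constant continuous_intros c)
  then have closed: "closedin (top_of_set {0..1}) T"
    by (simp add: T_def)
  have "\<exists>A. openin (top_of_set {0..1}) A \<and> t \<in> A \<and> A \<subseteq> T" if t: "t \<in> T" for t
  proof -
    have t01: "t \<in> {0..1}" and eq: "\<delta> t = \<delta>' t" using t by (auto simp: T_def)
    have "g (\<delta> t) \<notin> critical_values g"
      using assms(2) l1 t01 unfolding is_lift_def path_image_def by (metis ComplD image_eqI subsetD)
    then have "deriv g (\<delta> t) \<noteq> 0" by (auto simp: critical_values_def)
    then obtain r where r: "r > 0" "inj_on g (ball (\<delta> t) r)"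
      using has_complex_derivative_locally_injective[OF assms(1), of "\<delta> t"] by auto
    define A where "A = ({0..1} \<inter> \<delta> -` ball (\<delta> t) r) \<inter> ({0..1} \<inter> \<delta>' -` ball (\<delta> t) r)"
    have "openin (top_of_set {0..1}) A"
      unfolding A_def by (intro openin_Int continuous_openin_preimage_gen c open_ball)
    moreover have "t \<in> A" using r t01 eq by (auto simp: A_def)
    moreover have "A \<subseteq> T"
    proof
      fix s assume s: "s \<in> A"
      then have "g (\<delta> s) = g (\<delta>' s)" using l1 l2 by (auto simp: A_def is_lift_def)
      then show "s \<in> T" using s inj_onD[OF r(2)] by (auto simp: A_def T_def)
    qed
    ultimately show ?thesis by blast
  qed
  then have "openin (top_of_set {0..1}) T"
    by (subst openin_subopen) blast
  moreover have "T \<noteq> {}" using start by (auto simp: T_def pathstart_def intro!: exI[of _ 0])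
  ultimately have "T = {0..1}"
    using closed connected_clopen[of "{0..1::real}"] by auto
  then have "1 \<in> T" by simp
  then show ?thesis by (simp add: T_def pathfinish_def)
qed

lemma degree_diff_const:
  fixes q :: "'a::ring_1 poly"
  assumes "degree q > 0"
  shows "degree (q - [:w:]) = degree q"
  using assms degree_add_eq_left[of "- [:w:]" q] by (metis degree_minus degree_pCons_0 diff_conv_add_uminus)

lemma poly_surj_complex:
  fixes q :: "complex poly"
  assumes "degree q > 0"
  obtains z where "poly q z = w"
proof -
  have "degree (q - [:w:]) > 0"
    using assms by (simp add: degree_diff_const)
  then obtain z where "poly (q - [:w:]) z = 0"
    using alg_closed_imp_poly_has_root by blast
  then show thesis using that by simp
qed

text \<open>Chain rule at a \<open>q\<close>-preimage of the critical point. It ensures that a loop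
  that is admissible for the composition is also admissible for its left factor, where uniqueness of
  lifts is applied.\<close>

lemma critical_values_compose:
  fixes p q :: "complex poly"
  assumes "degree q > 0"
  shows "critical_values (poly p) \<subseteq> critical_values (poly p \<circ> poly q)"
proof
  fix w assume "w \<in> critical_values (poly p)"
  then obtain c where c: "w = poly p c" "deriv (poly p) c = 0"
    by (auto simp: critical_values_def)
  obtain z where z: "poly q z = c" using poly_surj_complex[OF assms] .
  have "deriv (poly p \<circ> poly q) z = deriv (poly p) (poly q z) * deriv (poly q) z"
    by (intro deriv_chain) (auto simp: field_differentiable_def intro: poly_DERIV)
  then show "w \<in> critical_values (poly p \<circ> poly q)"
    using c z by (auto simp: critical_values_def)
qed

lemma card_poly_fibre:
  fixes q :: "complex poly"
  assumes "degree q > 0"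
  shows "finite (fibre (poly q) w)" and "card (fibre (poly q) w) \<le> degree q"
proof -
  have eq: "fibre (poly q) w = {x. poly (q - [:w:]) x = 0}" by (auto simp: fibre_def)
  have deg: "degree (q - [:w:]) = degree q"
    using assms by (rule degree_diff_const)
  with assms have nz: "q - [:w:] \<noteq> 0" by auto
  show "finite (fibre (poly q) w)" unfolding eq by (rule poly_roots_finite[OF nz])
  show "card (fibre (poly q) w) \<le> degree q"
    unfolding eq using card_poly_roots_bound[OF nz] deg by simp
qed

text \<open>If \<open>\<delta>\<close> lifts a loop through \<open>g\<close>, then
  \<open>poly q \<circ> \<delta>\<close> lifts it through \<open>poly p\<close>. By uniqueness of
  lifts its end point depends only on its starting point, so monodromy maps points with equal
  \<open>q\<close>-value to points with equal \<open>q\<close>-value.\<close>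

lemma is_block_right_factor:
  fixes p q :: "complex poly"
  assumes g: "g = poly p \<circ> poly q" and "degree q > 0"
  shows "is_block (monodromy_group g x0) (fibre g x0) (fibre g x0 \<inter> fibre (poly q) w)"
  unfolding is_block_def
proof (intro conjI ballI)
  let ?S = "fibre g x0" and ?E = "fibre g x0 \<inter> fibre (poly q) w"
  fix \<sigma> assume "\<sigma> \<in> monodromy_group g x0"
  then obtain \<gamma> where perm: "\<sigma> permutes ?S" and \<gamma>: "path_image \<gamma> \<subseteq> - critical_values g"
    and lift: "\<And>x. x \<in> ?S \<Longrightarrow> \<exists>\<delta>. is_lift g \<gamma> \<delta> \<and> pathstart \<delta> = x \<and> pathfinish \<delta> = \<sigma> x"
    by (auto simp: monodromy_group_def)
  have \<gamma>p: "path_image \<gamma> \<subseteq> - critical_values (poly p)"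
    using \<gamma> critical_values_compose[OF assms(2), of p] g by auto
  have proj: "is_lift (poly p) \<gamma> (poly q \<circ> \<delta>)" if "is_lift g \<gamma> \<delta>" for \<delta>
    using that unfolding is_lift_def g
    by (auto intro!: path_continuous_image continuous_intros)
  have cong: "poly q (\<sigma> x) = poly q (\<sigma> y)"
    if xy: "x \<in> ?S" "y \<in> ?S" "poly q x = poly q y" for x y
  proof -
    obtain \<delta> \<delta>' where d: "is_lift g \<gamma> \<delta>" "pathstart \<delta> = x" "pathfinish \<delta> = \<sigma> x"
      "is_lift g \<gamma> \<delta>'" "pathstart \<delta>' = y" "pathfinish \<delta>' = \<sigma> y"
      using lift xy by meson
    have "pathfinish (poly q \<circ> \<delta>) = pathfinish (poly q \<circ> \<delta>')"
      by (rule lift_unique[OF _ \<gamma>p proj[OF d(1)] proj[OF d(4)]])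
        (use d xy in \<open>auto simp: pathstart_compose intro: holomorphic_on_poly\<close>)
    then show ?thesis using d by (simp add: pathfinish_compose)
  qed
  show "\<sigma> ` ?E \<inter> ?E = ?E \<or> \<sigma> ` ?E \<inter> ?E = {}"
  proof (cases "\<sigma> ` ?E \<inter> ?E = {}")
    case False
    then obtain x where x: "x \<in> ?E" "\<sigma> x \<in> ?E" by auto
    have "\<sigma> y \<in> ?E" if "y \<in> ?E" for y
      using that x cong[of y x] permutes_in_image[OF perm, of y] by (auto simp: fibre_def[of "poly q"])
    \<comment> \<open>So far \<open>\<sigma>\<close> only maps \<open>?E\<close> into itself;
      finiteness and injectivity make it onto.\<close>
    moreover have "finite ?E" using card_poly_fibre(1)[OF assms(2)] by blast
    ultimately have "\<sigma> ` ?E = ?E"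
      by (intro endo_inj_surj) (auto intro: inj_on_subset[OF permutes_inj[OF perm]])
    then show ?thesis by auto
  qed simp
qed simp

text \<open>The smallest block is the intersection of all blocks containing \<open>E\<close>. If one
  of them is disjoint from its image under \<open>g\<close>, so is the intersection. Otherwise each
  is contained in its image, and injectivity of \<open>g\<close> lets the image commute with the
  intersection.\<close>

lemma smallest_block_card_le:
  assumes B: "is_block G S B" "E \<subseteq> B" "finite B" and G: "\<And>g. g \<in> G \<Longrightarrow> inj g"
  shows "\<exists>B'. is_smallest_block G S E B' \<and> card B' \<le> card B"
proof -
  define \<B> where "\<B> = {B. is_block G S B \<and> E \<subseteq> B}"
  have B\<B>: "B \<in> \<B>" using B by (simp add: \<B>_def)
  have "is_block G S (\<Inter>\<B>)"
    unfolding is_block_def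
  proof (intro conjI ballI)
    show "\<Inter>\<B> \<subseteq> S" using B B\<B> by (auto simp: is_block_def)
    fix g assume g: "g \<in> G"
    show "g ` \<Inter>\<B> \<inter> \<Inter>\<B> = \<Inter>\<B> \<or> g ` \<Inter>\<B> \<inter> \<Inter>\<B> = {}"
    proof (cases "\<exists>C\<in>\<B>. g ` C \<inter> C = {}")
      case True
      then obtain C where "C \<in> \<B>" "g ` C \<inter> C = {}" by blast
      then have "g ` \<Inter>\<B> \<inter> \<Inter>\<B> \<subseteq> g ` C \<inter> C"
        by (intro Int_mono image_mono Inter_lower)
      then show ?thesis using \<open>g ` C \<inter> C = {}\<close> by simp
    next
      case False
      have "C \<subseteq> g ` C" if "C \<in> \<B>" for C
      proof -
        have "g ` C \<inter> C = C \<or> g ` C \<inter> C = {}"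
          using that g by (simp add: \<B>_def is_block_def)
        then show ?thesis using False that by blast
      qed
      then have "\<Inter>\<B> \<subseteq> (\<Inter>C\<in>\<B>. g ` C)" by (intro INF_greatest) blast
      also have "\<dots> = g ` \<Inter>\<B>"
        using image_INT[of g UNIV \<B> id B] G[OF g] B\<B> by auto
      finally show ?thesis by blast
    qed
  qed
  then have "is_smallest_block G S E (\<Inter>\<B>)"
    by (auto simp: is_smallest_block_def \<B>_def)
  moreover have "card (\<Inter>\<B>) \<le> card B"
    using B B\<B> by (intro card_mono) auto
  ultimately show ?thesis by blast
qed

lemma smallest_block_right_factor:
  fixes p q :: "complex poly"
  assumes g: "g = poly p \<circ> poly q" and "degree q > 0"
    and E: "E \<subseteq> fibre g x0" "\<And>x y. x \<in> E \<Longrightarrow> y \<in> E \<Longrightarrow> poly q x = poly q y"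
  shows "\<exists>B. is_smallest_block (monodromy_group g x0) (fibre g x0) E B \<and> card B \<le> degree q"
proof -
  \<comment> \<open>For empty \<open>E\<close> this is an arbitrary value, and any fibre will
    do.\<close>
  define w where "w = poly q (SOME x. x \<in> E)"
  have w: "poly q x = w" if "x \<in> E" for x
    unfolding w_def using E(2)[OF that someI[of "\<lambda>x. x \<in> E", OF that]] .
  let ?B = "fibre g x0 \<inter> fibre (poly q) w"
  have "finite ?B" "card ?B \<le> card (fibre (poly q) w)"
    using card_poly_fibre(1)[OF assms(2)] by (auto intro: card_mono)
  moreover have "E \<subseteq> ?B" using E(1) w by (auto simp: fibre_def)
  moreover have "inj \<sigma>" if "\<sigma> \<in> monodromy_group g x0" for \<sigma>
    using that permutes_inj by (auto simp: monodromy_group_def)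
  ultimately obtain B where
    "is_smallest_block (monodromy_group g x0) (fibre g x0) E B" "card B \<le> card ?B"
    using smallest_block_card_le[OF is_block_right_factor[OF g assms(2)], of E x0 w] by blast
  then show ?thesis
    using \<open>card ?B \<le> card (fibre (poly q) w)\<close> card_poly_fibre(2)[OF assms(2), of w]
    by (intro exI[of _ B]) simp
qed

lemma poly_funpow:
  fixes f :: "'a::idom poly"
  obtains q where "poly q = poly f ^^ n" and "degree q = degree f ^ n"
proof -
  have "\<exists>q. poly q = poly f ^^ n \<and> degree q = degree f ^ n"
  proof (induction n)
    case 0
    show ?case by (intro exI[of _ "[:0, 1:]"]) auto
  next
    case (Suc n)
    then obtain q where "poly q = poly f ^^ n" "degree q = degree f ^ n" by blast
    then show ?case
      by (intro exI[of _ "pcompose f q"]) (auto simp: poly_pcompose degree_pcompose)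
  qed
  then show thesis using that by blast
qed


section \<open>Fatou components with bounded orbits\<close>

text \<open>If this set is bounded, the components of its interior are Fatou components; working
  with them avoids handling normality directly.\<close>

definition filled_julia :: "complex poly \<Rightarrow> complex set" where
  "filled_julia f = {z. bounded (range (\<lambda>n. (poly f ^^ n) z))}"

lemma poly_in_filled_julia_iff [simp]: "poly f z \<in> filled_julia f \<longleftrightarrow> z \<in> filled_julia f"
proof -
  have "range (\<lambda>n. (poly f ^^ n) z) = insert z (range (\<lambda>n. (poly f ^^ n) (poly f z)))"
    (is "?L = ?R")
  proof
    show "?L \<subseteq> ?R"
    proof
      fix y assume "y \<in> ?L"
      then obtain n where "y = (poly f ^^ n) z" by blast
      then show "y \<in> ?R" by (cases n) (auto simp: funpow_swap1)
    qed
    show "?R \<subseteq> ?L"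
      by (auto intro: range_eqI[of _ _ 0] range_eqI[of _ _ "Suc _"] simp: funpow_swap1)
  qed
  then show ?thesis by (simp add: filled_julia_def)
qed

lemma funpow_in_filled_julia_iff [simp]:
  "(poly f ^^ n) z \<in> filled_julia f \<longleftrightarrow> z \<in> filled_julia f"
  by (induction n) auto

text \<open>
  Otherwise choose iterates that grow without bound at \<open>w\<close>: they stay bounded at \<open>z\<close>, so no subsequence
  can converge or tend to infinity locally uniformly on \<open>U\<close>.
\<close>
lemma normal_bounded_orbits:
  assumes U: "normal_family_on U (range (\<lambda>n. poly f ^^ n))"
    and "z \<in> U" "w \<in> U" "z \<in> filled_julia f"
  shows "w \<in> filled_julia f"
proof (rule ccontr)
  assume "w \<notin> filled_julia f"
  then have "\<forall>B. \<exists>n. B < norm ((poly f ^^ n) w)"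
    by (auto simp: filled_julia_def bounded_iff not_le)
  then have "\<forall>k::nat. \<exists>n. real k < norm ((poly f ^^ n) w)" by blast
  then obtain s :: "nat \<Rightarrow> nat" where s: "\<And>k. real k < norm ((poly f ^^ s k) w)" by metis
  have "range (\<lambda>k. poly f ^^ s k) \<subseteq> range (\<lambda>n. poly f ^^ n)" by auto
  then obtain r where r: "strict_mono r"
    and alt: "(\<exists>g. \<forall>K. compact K \<and> K \<subseteq> U \<longrightarrow> uniform_limit K (\<lambda>n. poly f ^^ s (r n)) g sequentially) \<or>
       (\<forall>K. compact K \<and> K \<subseteq> U \<longrightarrow>
          (\<forall>B. \<forall>\<^sub>F n in sequentially. \<forall>z\<in>K. B < norm ((poly f ^^ s (r n)) z)))"
    using U unfolding normal_family_on_def by blast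
  from alt show False
  proof
    assume "\<exists>g. \<forall>K. compact K \<and> K \<subseteq> U \<longrightarrow> uniform_limit K (\<lambda>n. poly f ^^ s (r n)) g sequentially"
    then obtain g where "uniform_limit {w} (\<lambda>n. poly f ^^ s (r n)) g sequentially"
      using \<open>w \<in> U\<close> by (meson compact_sing empty_subsetI insert_subset)
    then have "(\<lambda>n. (poly f ^^ s (r n)) w) \<longlonglongrightarrow> g w"
      by (rule tendsto_uniform_limitI) simp
    then have "Bseq (\<lambda>n. (poly f ^^ s (r n)) w)"
      using convergentI convergent_imp_Bseq by blast
    then obtain B where B: "\<And>n. norm ((poly f ^^ s (r n)) w) \<le> B"
      by (auto simp: Bseq_def)
    obtain n :: nat where "B < n" using reals_Archimedean2 by blast
    moreover have "real n \<le> real (r n)" using seq_suble[OF r] by simp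
    ultimately show False using B[of n] s[of "r n"] by linarith
  next
    assume inf: "\<forall>K. compact K \<and> K \<subseteq> U \<longrightarrow>
          (\<forall>B. \<forall>\<^sub>F n in sequentially. \<forall>z\<in>K. B < norm ((poly f ^^ s (r n)) z))"
    obtain B where B: "\<And>n. norm ((poly f ^^ n) z) \<le> B"
      using \<open>z \<in> filled_julia f\<close> by (auto simp: filled_julia_def bounded_iff)
    have "\<forall>\<^sub>F n in sequentially. \<forall>z\<in>{z}. B < norm ((poly f ^^ s (r n)) z)"
      using inf \<open>z \<in> U\<close> by (meson compact_sing empty_subsetI insert_subset)
    then obtain n where "B < norm ((poly f ^^ s (r n)) z)"
      by (auto dest!: eventually_happens)
    then show False using B[of "s (r n)"] by simp
  qed
qed

text \<open>Near an interior point all iterates are bounded by one constant, so Montel's theorem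
  applies.\<close>

lemma interior_filled_julia_subset_fatou:
  assumes "bounded (filled_julia f)"
  shows "interior (filled_julia f) \<subseteq> fatou_set f"
proof
  fix z assume "z \<in> interior (filled_julia f)"
  then obtain e where e: "e > 0" "ball z e \<subseteq> filled_julia f"
    by (auto simp: mem_interior)
  obtain B where B: "\<And>z. z \<in> filled_julia f \<Longrightarrow> norm z \<le> B"
    using assms by (auto simp: bounded_iff)
  have hol: "(poly f ^^ n) holomorphic_on S" for n S
    by (metis poly_funpow holomorphic_on_poly)
  have bd: "\<exists>B. \<forall>h\<in>range (\<lambda>n. poly f ^^ n). \<forall>z\<in>K. norm (h z) \<le> B" if "K \<subseteq> ball z e" for K
    using that e(2) by (intro exI[of _ B]) (auto intro!: B)
  have "normal_family_on (ball z e) (range (\<lambda>n. poly f ^^ n))"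
    unfolding normal_family_on_def
  proof (intro allI impI)
    fix F :: "nat \<Rightarrow> complex \<Rightarrow> complex" assume F: "range F \<subseteq> range (\<lambda>n. poly f ^^ n)"
    obtain g r where r: "strict_mono (r :: nat \<Rightarrow> nat)"
      "\<And>K. compact K \<Longrightarrow> K \<subseteq> ball z e \<Longrightarrow> uniform_limit K (F \<circ> r) g sequentially"
      by (rule Montel[OF open_ball _ _ F, of z e]) (use hol bd in auto)
    then show "\<exists>r. strict_mono r \<and>
           ((\<exists>g. \<forall>K. compact K \<and> K \<subseteq> ball z e \<longrightarrow> uniform_limit K (\<lambda>n. F (r n)) g sequentially) \<or>
            (\<forall>K. compact K \<and> K \<subseteq> ball z e \<longrightarrow>
               (\<forall>B. \<forall>\<^sub>F n in sequentially. \<forall>z\<in>K. B < norm (F (r n) z))))"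
      unfolding o_def by blast
  qed
  then show "z \<in> fatou_set f"
    using e(1) by (auto simp: fatou_set_def intro!: exI[of _ "ball z e"])
qed

text \<open>By normality, having a bounded orbit is a locally constant property on the Fatou set, so
  it cannot change within a connected subset.\<close>

lemma fatou_connected_subset_filled_julia:
  assumes C: "connected C" "C \<subseteq> fatou_set f" and z: "z \<in> C" "z \<in> filled_julia f"
  shows "C \<subseteq> interior (filled_julia f)"
proof -
  have dich: "\<exists>U. open U \<and> x \<in> U \<and> (U \<subseteq> filled_julia f \<or> U \<subseteq> - filled_julia f)"
    if "x \<in> C" for x
  proof -
    obtain U where U: "open U" "x \<in> U" "normal_family_on U (range (\<lambda>n. poly f ^^ n))"
      using \<open>x \<in> C\<close> C(2) by (auto simp: fatou_set_def)
    then show ?thesis using normal_bounded_orbits[OF U(3)] by blast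
  qed
  have "C \<subseteq> interior (filled_julia f) \<union> interior (- filled_julia f)"
    using dich interior_maximal by blast
  moreover have "interior (filled_julia f) \<inter> interior (- filled_julia f) \<inter> C = {}"
    using interior_subset[of "filled_julia f"] interior_subset[of "- filled_julia f"] by blast
  moreover have "interior (filled_julia f) \<inter> C \<noteq> {}"
    using dich[OF z(1)] z by (auto simp: interior_def)
  ultimately have "interior (- filled_julia f) \<inter> C = {}"
    using connectedD[OF C(1) open_interior open_interior] by blast
  then show ?thesis
    using \<open>C \<subseteq> interior (filled_julia f) \<union> interior (- filled_julia f)\<close> by blast
qed

lemma fatou_component_interior_filled_julia:
  assumes "bounded (filled_julia f)" and z: "z \<in> interior (filled_julia f)"
  shows "fatou_component f (connected_component_set (interior (filled_julia f)) z)"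
proof -
  have zF: "z \<in> fatou_set f" using interior_filled_julia_subset_fatou assms by blast
  have "connected_component_set (fatou_set f) z \<subseteq> interior (filled_julia f)"
    by (rule fatou_connected_subset_filled_julia[where z = z])
      (use zF z interior_subset in \<open>auto simp: connected_component_subset\<close>)
  then have "connected_component_set (fatou_set f) z
      \<subseteq> connected_component_set (interior (filled_julia f)) z"
    by (intro connected_component_maximal) (use zF in auto)
  moreover have "connected_component_set (interior (filled_julia f)) z
      \<subseteq> connected_component_set (fatou_set f) z"
    by (intro connected_component_mono interior_filled_julia_subset_fatou assms)
  ultimately have "connected_component_set (interior (filled_julia f)) z
      = connected_component_set (fatou_set f) z" by blast
  then show ?thesis
    using zF by (auto simp: fatou_component_def components_def)
qed

section \<open>Complete invariance and images of components\<close>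

lemma open_map_poly:
  fixes f :: "complex poly"
  assumes "degree f > 0" "open U"
  shows "open (poly f ` U)"
proof (rule open_mapping_thm[of _ UNIV])
  show "\<not> poly f constant_on UNIV"
  proof
    assume "poly f constant_on UNIV"
    then obtain c where c: "\<And>z. poly f z = c" by (auto simp: constant_on_def)
    obtain z where "poly f z = c + 1" using poly_surj_complex[OF assms(1)] .
    then show False using c by simp
  qed
qed (use assms in \<open>auto intro: holomorphic_on_poly\<close>)

lemma poly_in_interior_filled_julia_iff:
  assumes "degree f > 0"
  shows "poly f z \<in> interior (filled_julia f) \<longleftrightarrow> z \<in> interior (filled_julia f)"
proof
  assume z: "poly f z \<in> interior (filled_julia f)"
  have "open (poly f -` interior (filled_julia f))"
    by (intro open_vimage open_interior continuous_intros)
  moreover have "poly f -` interior (filled_julia f) \<subseteq> filled_julia f"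
    using interior_subset by fastforce
  ultimately show "z \<in> interior (filled_julia f)"
    using z interior_maximal by blast
next
  assume z: "z \<in> interior (filled_julia f)"
  have "open (poly f ` interior (filled_julia f))"
    using assms by (intro open_map_poly) auto
  moreover have "poly f ` interior (filled_julia f) \<subseteq> filled_julia f"
    using interior_subset by fastforce
  ultimately show "poly f z \<in> interior (filled_julia f)"
    using z interior_maximal by blast
qed

lemma image_component_interior_filled_julia:
  assumes "degree f > 0" "bounded (filled_julia f)" and z: "z \<in> interior (filled_julia f)"
  defines "\<Omega> \<equiv> interior (filled_julia f)"
  shows "poly f ` connected_component_set \<Omega> z = connected_component_set \<Omega> (poly f z)"
proof -
  let ?V = "connected_component_set \<Omega> z" and ?W = "connected_component_set \<Omega> (poly f z)"
  have zV: "z \<in> ?V" and V: "?V \<subseteq> \<Omega>"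
    using z by (auto simp: \<Omega>_def connected_component_subset)
  have iff: "poly f x \<in> \<Omega> \<longleftrightarrow> x \<in> \<Omega>" for x
    using poly_in_interior_filled_julia_iff[OF assms(1)] by (simp add: \<Omega>_def)
  have sub: "poly f ` ?V \<subseteq> ?W"
    using V zV iff
    by (intro connected_component_maximal connected_continuous_image continuous_intros) auto
  have "bounded ?V"
    using V interior_subset bounded_subset[OF assms(2)] unfolding \<Omega>_def by (meson order_trans)
  then have "closed (poly f ` closure ?V)"
    by (intro compact_imp_closed compact_continuous_image continuous_intros) auto
  moreover have "poly f ` ?V = ?W \<inter> poly f ` closure ?V"
  proof
    show "poly f ` ?V \<subseteq> ?W \<inter> poly f ` closure ?V" using sub closure_subset[of ?V] by blast
    show "?W \<inter> poly f ` closure ?V \<subseteq> poly f ` ?V"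
    proof
      fix y assume "y \<in> ?W \<inter> poly f ` closure ?V"
      then obtain x where x: "x \<in> closure ?V" "y = poly f x" "y \<in> ?W" by blast
      then have "y \<in> \<Omega>" using connected_component_subset by blast
      then have "x \<in> \<Omega>" using x iff by simp
      have "connected (insert x ?V)"
        by (rule connected_intermediate_closure[of ?V]) (use x closure_subset[of ?V] in auto)
      then have "insert x ?V \<subseteq> ?V"
        using zV V \<open>x \<in> \<Omega>\<close> by (intro connected_component_maximal) auto
      then show "y \<in> poly f ` ?V" using x by auto
    qed
  qed
  ultimately have "closedin (top_of_set ?W) (poly f ` ?V)"
    by (metis closedin_closed_Int)
  moreover have "openin (top_of_set ?W) (poly f ` ?V)"
    using sub assms(1)
    by (intro open_subset open_map_poly) (auto simp: \<Omega>_def intro: open_connected_component)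
  ultimately show ?thesis
    using connected_clopen[of ?W] zV connected_connected_component by blast
qed

lemma bounded_component_interior_filled_julia:
  assumes "bounded (filled_julia f)"
  shows "bounded (connected_component_set (interior (filled_julia f)) z)"
  by (meson assms bounded_subset connected_component_subset interior_subset)

text \<open>An intermediate value argument that will confine components: if a level curve of
  \<open>\<phi>\<close> misses the filled Julia set, a component cannot cross it.\<close>

lemma connected_less_level:
  fixes \<phi> :: "'a::topological_space \<Rightarrow> real"
  assumes "connected S" "continuous_on S \<phi>" "a \<in> S" "\<phi> a < c"
    and avoid: "\<And>x. x \<in> S \<Longrightarrow> \<phi> x \<noteq> c" and "x \<in> S"
  shows "\<phi> x < c"
proof (rule ccontr)
  assume "\<not> \<phi> x < c"
  moreover have "connected (\<phi> ` S)" using assms by (intro connected_continuous_image)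
  ultimately have "c \<in> \<phi> ` S"
    using assms connected_contains_Icc[of "\<phi> ` S" "\<phi> a" "\<phi> x"] by fastforce
  then show False using avoid by auto
qed


section \<open>The sextic\<close>

definition cubic :: "complex poly" where "cubic = [:0, -101, 0, 100:]"

definition quadratic :: "complex poly" where "quadratic = [:-1, 0, 1:]"

definition sextic :: "complex poly" where "sextic = pcompose cubic quadratic"

lemma poly_cubic: "poly cubic u = u * (100 * u\<^sup>2 - 101)"
  by (simp add: cubic_def algebra_simps power2_eq_square)

lemma poly_quadratic: "poly quadratic x = x\<^sup>2 - 1"
  by (simp add: quadratic_def power2_eq_square)

lemma poly_sextic: "poly sextic x = poly cubic (x\<^sup>2 - 1)"
  by (simp add: sextic_def poly_pcompose poly_quadratic)

lemma poly_cubic_minus: "poly cubic (- u) = - poly cubic u"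
  by (simp add: poly_cubic algebra_simps)

lemma degree_sextic: "degree sextic = 6"
  by (simp add: sextic_def degree_pcompose cubic_def quadratic_def)

lemma degree_quadratic_sq: "degree (quadratic\<^sup>2) = 4"
  by (subst degree_power_eq) (auto simp: quadratic_def)

lemma sextic_0 [simp]: "poly sextic 0 = 1" and sextic_1 [simp]: "poly sextic 1 = 0"
  by (simp_all add: poly_sextic poly_cubic)

lemma deriv_sextic_0: "deriv (poly sextic) 0 = 0"
proof -
  have "deriv (poly sextic) 0 = poly (pderiv sextic) 0"
    by (intro DERIV_imp_deriv poly_DERIV)
  also have "\<dots> = 0"
    by (simp add: sextic_def pderiv_pcompose quadratic_def pderiv_pCons)
  finally show ?thesis .
qed

lemma deriv_sextic_squared:
  "deriv (poly sextic ^^ 2) x = deriv (poly sextic) (poly sextic x) * deriv (poly sextic) x"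
proof -
  have "deriv (poly sextic \<circ> poly sextic) x
      = deriv (poly sextic) (poly sextic x) * deriv (poly sextic) x"
    by (intro deriv_chain) (auto simp: field_differentiable_def intro: poly_DERIV)
  then show ?thesis by (simp add: numeral_2_eq_2 o_def)
qed

section \<open>The four-element block of the second iterate\<close>

lemma sextic_squared_factor:
  obtains p where "poly sextic ^^ 2 = poly p \<circ> poly (quadratic\<^sup>2)"
proof
  \<comment> \<open>With \<open>u = w\<^sup>2\<close>, the square of \<open>poly cubic w\<close> is
    \<open>u * (100 * u - 101)\<^sup>2\<close>; subtracting \<open>1\<close> and expanding gives
    these coefficients.\<close>
  show "poly sextic ^^ 2
      = poly (pcompose cubic [:-1, 10201, -20200, 10000:]) \<circ> poly (quadratic\<^sup>2)"
  proof
    fix x :: complex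
    define w where "w = x\<^sup>2 - 1"
    have iter: "(poly sextic ^^ 2) x = poly sextic (poly sextic x)"
      by (simp add: numeral_2_eq_2)
    have "(poly cubic w)\<^sup>2 - 1 = poly [:-1, 10201, -20200, 10000:] (w\<^sup>2)"
      by (simp add: poly_cubic algebra_simps power2_eq_square)
    then show "(poly sextic ^^ 2) x
        = (poly (pcompose cubic [:-1, 10201, -20200, 10000:]) \<circ> poly (quadratic\<^sup>2)) x"
      by (simp only: iter comp_def poly_pcompose poly_power poly_quadratic poly_sextic
          w_def[symmetric])
  qed
qed

lemma sextic_squared_block:
  assumes p: "p \<notin> critical_values (poly sextic ^^ 2)"
  shows "\<exists>E. is_block (monodromy_group (poly sextic ^^ 2) p) (fibre (poly sextic ^^ 2) p) E \<and>
           card E = 4 \<and>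
           (\<exists>M1\<in>major_branches sextic 2 p. \<exists>M2\<in>major_branches sextic 2 p.
              M1 \<noteq> M2 \<and> card (E \<inter> M1) = 2 \<and> card (E \<inter> M2) = 2)"
proof -
  let ?h = "poly sextic"
  let ?S = "fibre (?h ^^ 2) p"
  obtain L where L: "?h ^^ 2 = poly L \<circ> poly (quadratic\<^sup>2)"
    using sextic_squared_factor .
  have h2: "(?h ^^ 2) x = ?h (?h x)" for x by (simp add: numeral_2_eq_2)
  obtain x1 where "?h x1 = p"
    using poly_surj_complex[of sextic] degree_sextic by auto
  moreover obtain y where "?h y = x1"
    using poly_surj_complex[of sextic] degree_sextic by auto
  ultimately have yS: "y \<in> ?S" by (simp add: fibre_def h2)
  define w where "w = y\<^sup>2 - 1"
  \<comment> \<open>Chosen so that \<open>quadratic\<close> takes the value \<open>-w\<close> at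
    \<open>z\<close> and \<open>w\<close> at \<open>y\<close>.\<close>
  define z where "z = csqrt (1 - w)"
  have y2: "y\<^sup>2 = 1 + w" and z2: "z\<^sup>2 = 1 - w" by (simp_all add: w_def z_def)
  \<comment> \<open>Since \<open>0\<close> is a critical point of \<open>?h\<close>, a regular fibre
    of the second iterate contains neither \<open>0\<close> nor a preimage of \<open>0\<close>. The
    first fact makes \<open>y\<close> and \<open>-y\<close> distinct; the second separates the
    branches over \<open>?h y\<close> and \<open>- ?h y\<close>.\<close>
  have nz: "x \<noteq> 0" "?h x \<noteq> 0" if "x \<in> ?S" for x
  proof -
    have "deriv (?h ^^ 2) x \<noteq> 0"
      using p that by (auto simp: critical_values_def fibre_def)
    then show "x \<noteq> 0" "?h x \<noteq> 0"
      using deriv_sextic_0 by (auto simp: deriv_sextic_squared)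
  qed
  have hy: "?h y = poly cubic w" and hz: "?h z = - ?h y"
    using y2 z2 by (simp_all add: poly_sextic poly_cubic_minus)
  have "w \<noteq> 0" using nz(2)[OF yS] hy by (auto simp: poly_cubic)
  define E where "E = ?S \<inter> fibre (poly (quadratic\<^sup>2)) (w\<^sup>2)"
  have "E = {x. (x\<^sup>2 - 1)\<^sup>2 = w\<^sup>2}"
    using yS by (auto simp: E_def fibre_def L poly_power poly_quadratic w_def)
  also have "\<dots> = {x. x\<^sup>2 = y\<^sup>2 \<or> x\<^sup>2 = z\<^sup>2}"
    unfolding y2 z2 by (auto simp: power2_eq_iff algebra_simps)
  also have "\<dots> = {y, -y, z, -z}"
    by (auto simp: power2_eq_iff)
  finally have E: "E = {y, -y, z, -z}" .
  then have zS: "z \<in> ?S" by (auto simp: E_def)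
  have "y\<^sup>2 \<noteq> z\<^sup>2" using \<open>w \<noteq> 0\<close> by (simp add: y2 z2)
  then have ne: "y \<noteq> z" "y \<noteq> -z" "-y \<noteq> z" "y \<noteq> -y" "z \<noteq> -z"
    using nz(1)[OF yS] nz(1)[OF zS] by (auto simp: power2_eq_iff)
  have hne: "?h y \<noteq> ?h z" using hz nz(2)[OF yS] by simp
  have even: "?h (- x) = ?h x" for x by (simp add: poly_sextic)
  let ?M = "\<lambda>x. {v \<in> ?S. ?h v = ?h x}"
  have M: "?M x \<in> major_branches sextic 2 p" if "x \<in> ?S" for x
    using that by (auto simp: major_branches_def fibre_def h2)
  have "{y, -y, z, -z} \<subseteq> ?S" using E by (auto simp: E_def)
  then have EM: "E \<inter> ?M y = {y, -y}" "E \<inter> ?M z = {z, -z}"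
    unfolding E using hne by (auto simp: even)
  have "?M y \<noteq> ?M z" using hne yS by auto
  moreover have "card (E \<inter> ?M y) = 2" "card (E \<inter> ?M z) = 2"
    unfolding EM using ne by auto
  ultimately have "\<exists>M1\<in>major_branches sextic 2 p. \<exists>M2\<in>major_branches sextic 2 p.
      M1 \<noteq> M2 \<and> card (E \<inter> M1) = 2 \<and> card (E \<inter> M2) = 2"
    by (intro bexI[OF bexI[OF _ M[OF zS]] M[OF yS]] conjI)
  moreover have "card E = 4" unfolding E using ne by auto
  moreover have "is_block (monodromy_group (?h ^^ 2) p) ?S E"
    unfolding E_def by (rule is_block_right_factor[OF L]) (simp add: degree_quadratic_sq)
  ultimately show ?thesis by (intro exI[of _ E] conjI)
qed

section \<open>Injectivity and escape estimates\<close>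

text \<open>The divided difference of \<open>cubic\<close> vanishes only if
  \<open>u\<^sup>2 + u * v + v\<^sup>2\<close> equals \<open>101/100\<close>, but on these discs its
  norm is at most \<open>3/16\<close>.\<close>

lemma cubic_inj_near_0:
  assumes "norm u < 1/4" "norm v < 1/4" "poly cubic u = poly cubic v"
  shows "u = v"
proof (rule ccontr)
  assume "u \<noteq> v"
  moreover have "(u - v) * (100 * (u\<^sup>2 + u * v + v\<^sup>2) - 101) = poly cubic u - poly cubic v"
    by (simp add: poly_cubic algebra_simps power2_eq_square)
  ultimately have "100 * (u\<^sup>2 + u * v + v\<^sup>2) - 101 = 0"
    using assms(3) by (metis diff_self mult_eq_0_iff right_minus_eq)
  then have "u\<^sup>2 + u * v + v\<^sup>2 = 101 / 100" by (simp add: field_simps)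
  then have "101 / 100 = norm (u\<^sup>2 + u * v + v\<^sup>2)" by (simp only:) simp
  also have "\<dots> \<le> norm u ^ 2 + norm u * norm v + norm v ^ 2"
    by (intro norm_triangle_le add_mono) (auto simp: norm_mult norm_power)
  also have "\<dots> \<le> (1/4)^2 + (1/4) * (1/4) + (1/4)^2"
    using assms by (intro add_mono power_mono mult_mono) auto
  finally show False by (simp add: power2_eq_square)
qed

text \<open>The same argument around \<open>-1\<close>, the value of \<open>quadratic\<close> at
  \<open>0\<close>; here \<open>199/100\<close> would have to be at most
  \<open>27/16\<close>.\<close>

lemma cubic_inj_near_minus_1:
  assumes "norm s < 1/4" "norm t < 1/4" "poly cubic (s - 1) = poly cubic (t - 1)"
  shows "s = t"
proof (rule ccontr)
  assume "s \<noteq> t"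
  moreover have "(s - t) * (199 - 100 * (3 * s + 3 * t - (s\<^sup>2 + s * t + t\<^sup>2)))
      = poly cubic (s - 1) - poly cubic (t - 1)"
    by (simp add: poly_cubic algebra_simps power2_eq_square)
  ultimately have "199 - 100 * (3 * s + 3 * t - (s\<^sup>2 + s * t + t\<^sup>2)) = 0"
    using assms(3) by (metis diff_self mult_eq_0_iff right_minus_eq)
  then have "3 * s + 3 * t - (s\<^sup>2 + s * t + t\<^sup>2) = 199 / 100"
    by (simp add: field_simps)
  then have "199 / 100 = norm (3 * s + 3 * t - (s\<^sup>2 + s * t + t\<^sup>2))" by (simp only:) simp
  also have "\<dots> \<le> norm (3 * s + 3 * t) + norm (s\<^sup>2 + s * t + t\<^sup>2)"
    by (rule norm_triangle_ineq4)
  also have "\<dots> \<le> (3 * norm s + 3 * norm t) + (norm s ^ 2 + norm s * norm t + norm t ^ 2)"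
    by (intro norm_triangle_le add_mono) (auto simp: norm_mult norm_power)
  also have "\<dots> \<le> (3 * (1/4) + 3 * (1/4)) + ((1/4)^2 + (1/4) * (1/4) + (1/4)^2)"
    using assms by (intro add_mono power_mono mult_mono) auto
  finally show False by (simp add: power2_eq_square)
qed

lemma filled_julia_sextic_subset: "filled_julia sextic \<subseteq> cball 0 2"
proof
  fix z assume z: "z \<in> filled_julia sextic"
  have expand: "2 * norm x \<le> norm (poly sextic x)" if x: "norm x > 2" for x
  proof -
    define u where "u = x\<^sup>2 - 1"
    have "norm x * norm x \<ge> 2 * norm x" using x by (intro mult_right_mono) auto
    then have u: "norm u \<ge> 2 * norm x - 1"
      using norm_triangle_ineq2[of "x\<^sup>2" 1] by (simp add: u_def norm_mult power2_eq_square)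
    then have "norm u \<ge> 3" using x by simp
    then have "norm u * norm u \<ge> 3 * 3" by (intro mult_mono) auto
    then have "norm (100 * u\<^sup>2 - 101) \<ge> 2"
      using norm_triangle_ineq2[of "100 * u\<^sup>2" 101] by (simp add: norm_mult power2_eq_square)
    then have "norm u * norm (100 * u\<^sup>2 - 101) \<ge> norm u * 2"
      by (intro mult_left_mono) auto
    then show ?thesis
      using u x by (simp add: poly_sextic poly_cubic u_def norm_mult)
  qed
  show "z \<in> cball 0 2"
  proof (rule ccontr)
    assume "z \<notin> cball 0 2"
    then have z2: "norm z > 2" by simp
    have grow: "2 ^ n * norm z \<le> norm ((poly sextic ^^ n) z)" for n
    proof (induction n)
      case (Suc n)
      have "1 * norm z \<le> 2 ^ n * norm z" by (intro mult_right_mono) auto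
      then show ?case using Suc z2 expand[of "(poly sextic ^^ n) z"] by simp
    qed simp
    obtain B where B: "\<And>n. norm ((poly sextic ^^ n) z) \<le> B"
      using z by (auto simp: filled_julia_def bounded_iff)
    obtain n :: nat where "B < 2 ^ n" using real_arch_pow[of 2 B] by auto
    also have "2 ^ n * 1 \<le> 2 ^ n * norm z" using z2 by (intro mult_left_mono) auto
    finally show False using grow[of n] B[of n] by simp
  qed
qed

text \<open>On both curves the large coefficients push the image outside the disc of radius
  \<open>2\<close>, which contains the filled Julia set. These curves serve as barriers around the
  cycle points \<open>1\<close> and \<open>0\<close>.\<close>

lemma filled_julia_sextic_avoids:
  assumes z: "z \<in> filled_julia sextic"
  shows "norm (z\<^sup>2 - 1) \<noteq> 1/4" and "norm (z\<^sup>2) \<noteq> 1/4"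
proof -
  define u where "u = z\<^sup>2 - 1"
  have "poly sextic z \<in> cball 0 2" by (rule subsetD[OF filled_julia_sextic_subset]) (simp add: z)
  then have le: "norm u * norm (100 * u\<^sup>2 - 101) \<le> 2"
    by (simp add: poly_sextic poly_cubic u_def norm_mult)
  show "norm (z\<^sup>2 - 1) \<noteq> 1/4"
  proof
    assume "norm (z\<^sup>2 - 1) = 1/4"
    then have u: "norm u = 1/4" by (simp add: u_def)
    then have "norm (100 * u\<^sup>2) = 100 / 16"
      unfolding norm_mult norm_power u by (simp add: power2_eq_square)
    then have "norm (101 - 100 * u\<^sup>2) \<ge> 94"
      using norm_triangle_ineq2[of 101 "100 * u\<^sup>2"] by simp
    then show False using le u by (simp add: norm_minus_commute)
  qed
  show "norm (z\<^sup>2) \<noteq> 1/4"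
  proof
    assume z2: "norm (z\<^sup>2) = 1/4"
    have u: "norm u \<ge> 3/4"
      using norm_triangle_ineq2[of 1 "z\<^sup>2"] z2 by (simp add: u_def norm_minus_commute)
    have "norm (z\<^sup>2 - 2) \<ge> 7/4"
      using norm_triangle_ineq2[of 2 "z\<^sup>2"] z2 by (simp add: norm_minus_commute)
    then have "norm (100 * (z\<^sup>2 * (z\<^sup>2 - 2))) \<ge> 43"
      using z2 by (simp only: norm_mult) simp
    \<comment> \<open>At \<open>z = 0\<close> the left side is only \<open>-1\<close>; expanding
      around this point shows that it is large once \<open>norm (z\<^sup>2)\<close> is
      \<open>1/4\<close>.\<close>
    moreover have "100 * u\<^sup>2 - 101 = 100 * (z\<^sup>2 * (z\<^sup>2 - 2)) - 1"
      by (simp add: u_def algebra_simps power2_eq_square)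
    ultimately have "norm (100 * u\<^sup>2 - 101) \<ge> 42"
      using norm_triangle_ineq2[of "100 * (z\<^sup>2 * (z\<^sup>2 - 2))" 1] by simp
    then have "norm u * norm (100 * u\<^sup>2 - 101) \<ge> 3/4 * 42"
      using u by (intro mult_mono) auto
    then show False using le by simp
  qed
qed

lemma bounded_filled_julia_sextic: "bounded (filled_julia sextic)"
  using bounded_subset[OF bounded_cball filled_julia_sextic_subset] .

section \<open>The super-attracting cycle and its components\<close>

text \<open>The second iterate vanishes to second order at \<open>0\<close>. The crude factors
  \<open>600\<close>, \<open>3\<close> and \<open>201\<close> below bound it by
  \<open>361800 * norm x ^ 2\<close> on this disc, and \<open>361800\<close> is less than
  \<open>10^6\<close>.\<close>

lemma sextic_squared_near_0:
  assumes x: "norm x \<le> 1/10^6"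
  shows "norm ((poly sextic ^^ 2) x) \<le> 1/10^6"
proof -
  define s where "s = x\<^sup>2"
  define t where "t = s * (199 - 300 * s + 100 * s\<^sup>2)"
  have ht: "poly sextic x = 1 + t"
    by (simp add: poly_sextic poly_cubic t_def s_def algebra_simps power2_eq_square)
  have s: "norm s \<le> 1/10^12"
  proof -
    have "norm x ^ 2 \<le> (1/10^6)^2" using x by (intro power_mono) auto
    also have "(1/10^6)^2 = (1/10^12 :: real)" by (simp add: power2_eq_square)
    finally show ?thesis by (simp only: s_def norm_power)
  qed
  have s2: "norm (s\<^sup>2) \<le> 1"
    using s by (simp add: norm_power power_le_one)
  have "norm (199 - 300 * s + 100 * s\<^sup>2) \<le> 199 + 300 * norm s + 100 * norm (s\<^sup>2)"
    by (intro norm_triangle_le add_mono norm_triangle_le_diff) (auto simp: norm_mult)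
  also have "\<dots> \<le> 600" using s s2 by simp
  finally have "norm t \<le> 1/10^12 * 600"
    unfolding t_def norm_mult using s by (intro mult_mono) auto
  then have t: "norm t \<le> 6/10^10" by simp
  define u where "u = t * (2 + t)"
  have "norm (2 + t) \<le> 3" using t norm_triangle_ineq[of 2 t] by simp
  then have "norm u \<le> 6/10^10 * 3" unfolding u_def norm_mult using t by (intro mult_mono) auto
  then have u: "norm u \<le> 18/10^10" by simp
  then have "norm (u\<^sup>2) \<le> 1" by (simp add: norm_power power_le_one)
  then have "norm (100 * u\<^sup>2 - 101) \<le> 201"
    using norm_triangle_ineq4[of "100 * u\<^sup>2" 101] by (simp add: norm_mult)
  then have "norm (u * (100 * u\<^sup>2 - 101)) \<le> 18/10^10 * 201"
    unfolding norm_mult using u by (intro mult_mono) auto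
  moreover have "(poly sextic ^^ 2) x = u * (100 * u\<^sup>2 - 101)"
  proof -
    have "(poly sextic ^^ 2) x = poly sextic (1 + t)" by (simp add: numeral_2_eq_2 ht)
    also have "\<dots> = poly cubic ((1 + t)\<^sup>2 - 1)" by (simp add: poly_sextic)
    also have "(1 + t)\<^sup>2 - 1 = u" by (simp add: u_def algebra_simps power2_eq_square)
    finally show ?thesis by (simp add: poly_cubic)
  qed
  ultimately show ?thesis by simp
qed

text \<open>The disc is invariant under the second iterate, so every orbit starting in it stays in
  the disc and its compact image.\<close>

lemma zero_in_interior: "0 \<in> interior (filled_julia sextic)"
proof -
  let ?D = "cball (0::complex) (1/10^6)"
  have "?D \<subseteq> filled_julia sextic"
  proof
    fix z assume z: "z \<in> ?D"
    have even: "((poly sextic ^^ 2) ^^ k) z \<in> ?D" for k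
      by (induction k) (use z sextic_squared_near_0 in auto)
    have orbit: "(poly sextic ^^ n) z \<in> ?D \<union> poly sextic ` ?D" for n
    proof -
      have eq: "(poly sextic ^^ (2 * k)) z = ((poly sextic ^^ 2) ^^ k) z" for k
        by (simp add: funpow_mult)
      obtain k where "n = 2 * k \<or> n = Suc (2 * k)" by (metis oddE evenE Suc_eq_plus1)
      then show ?thesis
      proof
        assume "n = 2 * k"
        then show ?thesis using even[of k] eq[of k] by simp
      next
        assume "n = Suc (2 * k)"
        then have "(poly sextic ^^ n) z = poly sextic (((poly sextic ^^ 2) ^^ k) z)"
          using eq[of k] by simp
        then show ?thesis using even[of k] by blast
      qed
    qed
    have "bounded (?D \<union> poly sextic ` ?D)"
      by (intro bounded_Un[THEN iffD2] conjI bounded_cball compact_imp_bounded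
          compact_continuous_image continuous_intros compact_cball)
    then show "z \<in> filled_julia sextic"
      unfolding filled_julia_def mem_Collect_eq
      by (rule bounded_subset) (use orbit in blast)
  qed
  then have "ball 0 (1/10^6) \<subseteq> filled_julia sextic"
    using ball_subset_cball by blast
  then show ?thesis
    unfolding mem_interior by (intro exI[of _ "1/10^6"]) auto
qed

lemma one_in_interior: "1 \<in> interior (filled_julia sextic)"
  using poly_in_interior_filled_julia_iff[of sextic 1] zero_in_interior
  by (simp add: degree_sextic)

abbreviation sextic_component :: "complex \<Rightarrow> complex set" where
  "sextic_component \<equiv> connected_component_set (interior (filled_julia sextic))"

lemma image_sextic_component:
  "poly sextic ` sextic_component 0 = sextic_component 1"
  "poly sextic ` sextic_component 1 = sextic_component 0"
  using image_component_interior_filled_julia[of sextic 0]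
    image_component_interior_filled_julia[of sextic 1]
    zero_in_interior one_in_interior bounded_filled_julia_sextic
  by (simp_all add: degree_sextic)

lemma image_sextic_squared_component: "(poly sextic ^^ 2) ` sextic_component 1 = sextic_component 1"
proof -
  have "(poly sextic ^^ 2) ` sextic_component 1 = poly sextic ` poly sextic ` sextic_component 1"
    by (auto simp: numeral_2_eq_2 image_comp)
  then show ?thesis by (simp only: image_sextic_component)
qed

lemma sextic_component_filled_julia: "x \<in> sextic_component z \<Longrightarrow> x \<in> filled_julia sextic"
  using connected_component_subset interior_subset by blast

lemma sextic_component_0_bound:
  assumes "x \<in> sextic_component 0"
  shows "norm (x\<^sup>2) < 1/4"
proof (rule connected_less_level[where \<phi> = "\<lambda>x. norm (x\<^sup>2)" and a = 0 and S = "sextic_component 0"])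
  show "norm (y\<^sup>2) \<noteq> 1/4" if "y \<in> sextic_component 0" for y
    using filled_julia_sextic_avoids(2) sextic_component_filled_julia that by blast
qed (use assms zero_in_interior in \<open>auto intro!: continuous_intros\<close>)

lemma sextic_component_1_bound:
  assumes "x \<in> sextic_component 1"
  shows "norm (x\<^sup>2 - 1) < 1/4" and "Re x > 0"
proof -
  have *: "norm (y\<^sup>2 - 1) < 1/4" if "y \<in> sextic_component 1" for y
  proof (rule connected_less_level[where \<phi> = "\<lambda>x. norm (x\<^sup>2 - 1)" and a = 1
        and S = "sextic_component 1"])
    show "norm (y\<^sup>2 - 1) \<noteq> 1/4" if "y \<in> sextic_component 1" for y
      using filled_julia_sextic_avoids(1) sextic_component_filled_julia that by blast
  qed (use that one_in_interior in \<open>auto intro!: continuous_intros\<close>)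
  then show "norm (x\<^sup>2 - 1) < 1/4" using assms .
  \<comment> \<open>The region \<open>norm (x\<^sup>2 - 1) < 1/4\<close> also has a piece around
    \<open>-1\<close>. The imaginary axis separates it from the piece around \<open>1\<close>,
    because there \<open>x\<^sup>2 - 1\<close> has real part at most \<open>-1\<close>.\<close>
  have "- Re x < 0"
  proof (rule connected_less_level[where \<phi> = "\<lambda>x. - Re x" and a = 1 and S = "sextic_component 1"])
    fix y assume y: "y \<in> sextic_component 1"
    show "- Re y \<noteq> 0"
    proof
      assume "- Re y = 0"
      then have "Re (y\<^sup>2 - 1) \<le> -1" by (simp add: power2_eq_square)
      then show False using *[OF y] abs_Re_le_cmod[of "y\<^sup>2 - 1"] by linarith
    qed
  qed (use assms one_in_interior in \<open>auto intro!: continuous_intros\<close>)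
  then show "Re x > 0" by simp
qed

text \<open>The cubic is injective on the values of \<open>quadratic\<close> here, and squaring is
  injective on the right half plane.\<close>

lemma inj_on_sextic_component_1: "inj_on (poly sextic) (sextic_component 1)"
proof
  fix x y assume x: "x \<in> sextic_component 1" and y: "y \<in> sextic_component 1"
    and "poly sextic x = poly sextic y"
  then have "x\<^sup>2 - 1 = y\<^sup>2 - 1"
    using cubic_inj_near_0 sextic_component_1_bound(1) by (simp add: poly_sextic)
  then have "x = y \<or> x = - y" by (simp add: power2_eq_iff)
  then show "x = y"
    using sextic_component_1_bound(2)[OF x] sextic_component_1_bound(2)[OF y] by auto
qed

lemma sextic_eq_on_component_0:
  assumes "x \<in> sextic_component 0" "y \<in> sextic_component 0" "poly sextic x = poly sextic y"
  shows "x = y \<or> x = - y"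
  using cubic_inj_near_minus_1 assms sextic_component_0_bound
  by (simp add: poly_sextic power2_eq_iff[symmetric])

lemma sextic_squared_eq_on_component_1:
  assumes x: "x \<in> sextic_component 1" and y: "y \<in> sextic_component 1"
    and eq: "(poly sextic ^^ 2) x = (poly sextic ^^ 2) y"
  shows "poly (quadratic\<^sup>2) x = poly (quadratic\<^sup>2) y"
proof -
  have "poly sextic x \<in> sextic_component 0" "poly sextic y \<in> sextic_component 0"
    using x y image_sextic_component(2) by blast+
  moreover have "poly sextic (poly sextic x) = poly sextic (poly sextic y)"
    using eq by (simp add: numeral_2_eq_2)
  ultimately have "poly sextic x = poly sextic y \<or> poly sextic x = - poly sextic y"
    by (rule sextic_eq_on_component_0)
  then have "poly cubic (x\<^sup>2 - 1) = poly cubic (y\<^sup>2 - 1) \<or>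
      poly cubic (x\<^sup>2 - 1) = poly cubic (- (y\<^sup>2 - 1))"
    by (simp only: poly_sextic poly_cubic_minus)
  then have "x\<^sup>2 - 1 = y\<^sup>2 - 1 \<or> x\<^sup>2 - 1 = - (y\<^sup>2 - 1)"
    using sextic_component_1_bound(1)[OF x] sextic_component_1_bound(1)[OF y]
    by (metis cubic_inj_near_0 norm_minus_cancel)
  then show ?thesis by (simp only: poly_power poly_quadratic power2_eq_iff)
qed

lemma even_funpow_sextic_component_1:
  assumes "even n" "x \<in> sextic_component 1"
  shows "(poly sextic ^^ n) x \<in> sextic_component 1"
proof -
  obtain k where "n = 2 * k" using assms(1) by (rule evenE)
  moreover have "((poly sextic ^^ 2) ^^ k) x \<in> sextic_component 1"
    by (induction k) (use assms(2) image_sextic_squared_component in auto)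
  ultimately show ?thesis by (simp add: funpow_mult)
qed

text \<open>Stated for an arbitrary part of the fibre inside the component of \<open>1\<close>,
  which covers all forms of admissible pairs at once.\<close>

lemma sextic_smallest_block:
  assumes "N \<ge> 1" and E: "E \<subseteq> fibre (poly sextic ^^ N) p \<inter> sextic_component 1"
  shows "\<exists>B. is_smallest_block (monodromy_group (poly sextic ^^ N) p)
               (fibre (poly sextic ^^ N) p) E B \<and> card B \<le> 6 ^ (N - 1)"
proof -
  have E_sub: "E \<subseteq> fibre (poly sextic ^^ N) p" using E by blast
  have E_fibre: "(poly sextic ^^ N) x = p" if "x \<in> E" for x
    using that E by (auto simp: fibre_def)
  have E_component: "x \<in> sextic_component 1" if "x \<in> E" for x
    using that E by blast
  show ?thesis
  proof (cases "odd N")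
    case True
    then obtain M where M: "N = Suc M" "even M" by (cases N) auto
    obtain q where q: "poly q = poly sextic ^^ M" "degree q = 6 ^ M"
      using poly_funpow[where f = sextic and n = M] by (auto simp: degree_sextic)
    have g: "poly sextic ^^ N = poly sextic \<circ> poly q" by (simp add: M q)
    have eq: "poly q x = poly q y" if "x \<in> E" "y \<in> E" for x y
    proof (rule inj_onD[OF inj_on_sextic_component_1])
      show "poly sextic (poly q x) = poly sextic (poly q y)"
        using that[THEN E_fibre] by (simp add: g)
      show "poly q x \<in> sextic_component 1" "poly q y \<in> sextic_component 1"
        unfolding q by (rule even_funpow_sextic_component_1[OF M(2) that(1)[THEN E_component]],
            rule even_funpow_sextic_component_1[OF M(2) that(2)[THEN E_component]])
    qed
    have "degree q > 0" "degree q \<le> 6 ^ (N - 1)" by (simp_all add: q M(1))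
    then show ?thesis
      using smallest_block_right_factor[OF g _ E_sub eq] by (meson order_trans)
  next
    case False
    then obtain M where M: "N = 2 + M" "even M"
      using assms(1) by (metis One_nat_def Suc_1 Suc_leI even_add even_numeral le_Suc_ex nat_less_le
          numeral_1_eq_Suc_0 numeral_One odd_one)
    obtain r where r: "poly r = poly sextic ^^ M" "degree r = 6 ^ M"
      using poly_funpow[where f = sextic and n = M] by (auto simp: degree_sextic)
    \<comment> \<open>Here \<open>poly sextic ^^ (N - 1)\<close> need not be constant on
      \<open>E\<close>, as a sign may be lost one step earlier; this right factor of smaller degree
      is insensitive to the sign.\<close>
    define q where "q = pcompose (quadratic\<^sup>2) r"
    have q: "degree q = 4 * 6 ^ M" "poly q x = poly (quadratic\<^sup>2) (poly r x)" for x
      by (simp_all add: q_def degree_pcompose poly_pcompose degree_quadratic_sq r)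
    obtain L where L: "poly sextic ^^ 2 = poly L \<circ> poly (quadratic\<^sup>2)"
      using sextic_squared_factor .
    have N: "poly sextic ^^ N = (poly sextic ^^ 2) \<circ> poly r"
      unfolding M r by (rule funpow_add)
    have g: "poly sextic ^^ N = poly L \<circ> poly q"
      unfolding N L by (auto simp: q fun_eq_iff)
    have eq: "poly q x = poly q y" if "x \<in> E" "y \<in> E" for x y
      unfolding q
    proof (rule sextic_squared_eq_on_component_1)
      show "(poly sextic ^^ 2) (poly r x) = (poly sextic ^^ 2) (poly r y)"
        using that[THEN E_fibre] by (simp add: N)
      show "poly r x \<in> sextic_component 1" "poly r y \<in> sextic_component 1"
        unfolding r by (rule even_funpow_sextic_component_1[OF M(2) that(1)[THEN E_component]],
            rule even_funpow_sextic_component_1[OF M(2) that(2)[THEN E_component]])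
    qed
    \<comment> \<open>As \<open>N - 1 = M + 1\<close>, the bound amounts to
      \<open>4 \<le> 6\<close>.\<close>
    have "degree q > 0" "degree q \<le> 6 ^ (N - 1)" by (simp_all add: q(1) M(1))
    then show ?thesis
      using smallest_block_right_factor[OF g _ E_sub eq] by (meson order_trans)
  qed
qed

lemma superattracting_component_sextic: "superattracting_component sextic (sextic_component 1)"
proof -
  have "superattracting_point sextic 1"
    unfolding superattracting_point_def
    \<comment> \<open>By the chain rule the multiplier of the 2-cycle contains the factor
      \<open>deriv (poly sextic) 0\<close>, which is zero.\<close>
    by (intro exI[of _ 2]) (simp add: deriv_sextic_squared deriv_sextic_0, simp add: numeral_2_eq_2)
  moreover have "1 \<in> sextic_component 1" using one_in_interior by simp
  moreover have "fatou_component sextic (sextic_component 1)"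
    by (intro fatou_component_interior_filled_julia bounded_filled_julia_sextic one_in_interior)
  ultimately show ?thesis
    unfolding superattracting_component_def
    using image_sextic_squared_component zero_less_numeral by blast
qed


theorem theorem4p6:
  "\<exists>h :: complex poly. degree h = 6 \<and>
     (\<forall>p. p \<notin> critical_values (poly h ^^ 2) \<longrightarrow>
        (\<exists>E. is_block (monodromy_group (poly h ^^ 2) p) (fibre (poly h ^^ 2) p) E \<and>
             card E = 4 \<and>
             (\<exists>M1\<in>major_branches h 2 p. \<exists>M2\<in>major_branches h 2 p.
                M1 \<noteq> M2 \<and> card (E \<inter> M1) = 2 \<and> card (E \<inter> M2) = 2))) \<and>
     (\<exists>V. fatou_component h V \<and> bounded V \<and> eventually_attracted h V \<and>
        (\<forall>N\<ge>1. \<forall>p E. admissible_pair h V N p E \<longrightarrow>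
           (\<exists>B. is_smallest_block (monodromy_group (poly h ^^ N) p) (fibre (poly h ^^ N) p) E B \<and>
                card B \<le> 6 ^ (N - 1))))"
proof (rule exI[of _ sextic], intro conjI allI impI)
  show "degree sextic = 6" by (rule degree_sextic)
next
  fix p assume "p \<notin> critical_values (poly sextic ^^ 2)"
  then show "\<exists>E. is_block (monodromy_group (poly sextic ^^ 2) p) (fibre (poly sextic ^^ 2) p) E \<and>
           card E = 4 \<and>
           (\<exists>M1\<in>major_branches sextic 2 p. \<exists>M2\<in>major_branches sextic 2 p.
              M1 \<noteq> M2 \<and> card (E \<inter> M1) = 2 \<and> card (E \<inter> M2) = 2)"
    by (rule sextic_squared_block)
next
  let ?V = "sextic_component 1"
  have "superattracting_component sextic ((poly sextic ^^ 0) ` ?V)"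
    using superattracting_component_sextic by simp
  then have "eventually_attracted sextic ?V"
    unfolding eventually_attracted_def eventually_onto_def by blast
  moreover have "fatou_component sextic ?V"
    using superattracting_component_sextic by (simp add: superattracting_component_def)
  moreover have "bounded ?V"
    by (intro bounded_component_interior_filled_julia bounded_filled_julia_sextic)
  moreover have "\<exists>B. is_smallest_block (monodromy_group (poly sextic ^^ N) p)
       (fibre (poly sextic ^^ N) p) E B \<and> card B \<le> 6 ^ (N - 1)"
    if "N \<ge> 1" "admissible_pair sextic ?V N p E" for N p E
  proof (rule sextic_smallest_block[OF that(1)])
    show "E \<subseteq> fibre (poly sextic ^^ N) p \<inter> ?V"
      using that(2) unfolding admissible_pair_def by blast
  qed
  ultimately show "\<exists>V. fatou_component sextic V \<and> bounded V \<and> eventually_attracted sextic V \<and>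
        (\<forall>N\<ge>1. \<forall>p E. admissible_pair sextic V N p E \<longrightarrow>
           (\<exists>B. is_smallest_block (monodromy_group (poly sextic ^^ N) p)
                (fibre (poly sextic ^^ N) p) E B \<and> card B \<le> 6 ^ (N - 1)))"
    by (intro exI[of _ ?V]) blast
qed

end
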